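(* Let $M$ be a non-degenerate Orlicz function satisfying the $\Delta_2$ condition at zero, and let $f:\ell_M\to\mathbb{R}\cup\{+\infty\}$ be a proper, lower semicontinuous and bounded below function. Then for each $\varepsilon>0$ there is $a\in\ell_\infty$ such that $\|a\|_\infty<\varepsilon$ and the function $f+g_a$ attains its minimum on $\ell_M$, where $g_a(x)=\sum_{n=1}^\infty a_nM(|x_n|)$ for $x=(x_n)_{n\ge1}\in\ell_M$.
   Context: An Orlicz function is a continuous, non-decreasing, convex function $M:[0,\infty)\to[0,\infty)$ with $M(0)=0$ and $\lim_{t\to\infty}M(t)=\infty$. It is degenerate if $M(t)=0$ for some $t>0$, and non-degenerate otherwise. A non-degenerate $M$ satisfies the $\Delta_2$ condition at zero if $\liminf_{t\downarrow0}M(t)/M(2t)>0$. $\ell_\infty$ is the space of bounded real sequences with $\|a\|_\infty=\sup_n|a_n|$. For $x\in\ell_\infty$ put $\sigma_M(x)=\sum_{n=1}^\infty M(|x_n|)\in[0,\infty]$. The Orlicz sequence space $\ell_M$ is the linear space of all $x\in\ell_\infty$ with $\sigma_M(x/\rho)<\infty$ for some $\rho>0$, equipped with the norm $\|x\|=\inf\{\rho>0:\sigma_M(x/\rho)\le1\}$; it is a Banach space. When $M$ is non-degenerate and satisfies $\Delta_2$ at zero, $\sigma_M$ is finite on $\ell_M$ and, for $a\in\ell_\infty$, the series defining $g_a(x)$ converges absolutely for every $x\in\ell_M$. A function $f$ with values in $\mathbb{R}\cup\{+\infty\}$ is proper if it is finite at some point. *)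

theory Defs
  imports "HOL-Analysis.Analysis"
begin

text \<open>Sequences are functions on \<^typ>\<open>nat\<close>, indexed from 0 instead of 1. A function
  $[0,\infty)\to[0,\infty)$ is a real function whose values at negative arguments are irrelevant.\<close>

definition orlicz :: "(real \<Rightarrow> real) \<Rightarrow> bool" where
  "orlicz M \<longleftrightarrow> (\<forall>t\<ge>0. 0 \<le> M t) \<and> continuous_on {0..} M \<and> mono_on {0..} M
     \<and> convex_on {0..} M \<and> M 0 = 0 \<and> filterlim M at_top at_top"

definition degenerate :: "(real \<Rightarrow> real) \<Rightarrow> bool" where
  "degenerate M \<longleftrightarrow> (\<exists>t>0. M t = 0)"

definition delta2_at_zero :: "(real \<Rightarrow> real) \<Rightarrow> bool" where
  "delta2_at_zero M \<longleftrightarrow> Liminf (at_right 0) (\<lambda>t. ereal (M t / M (2 * t))) > 0"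

definition linf :: "(nat \<Rightarrow> real) set" where
  "linf = {a. bounded (range a)}"

definition linf_norm :: "(nat \<Rightarrow> real) \<Rightarrow> real" where
  "linf_norm a = (SUP n. \<bar>a n\<bar>)"

definition orlicz_modular :: "(real \<Rightarrow> real) \<Rightarrow> (nat \<Rightarrow> real) \<Rightarrow> ennreal" where
  "orlicz_modular M x = (\<Sum>n. ennreal (M \<bar>x n\<bar>))"

definition orlicz_space :: "(real \<Rightarrow> real) \<Rightarrow> (nat \<Rightarrow> real) set" where
  "orlicz_space M = {x \<in> linf. \<exists>\<rho>>0. orlicz_modular M (\<lambda>n. x n / \<rho>) < \<infinity>}"

definition orlicz_norm :: "(real \<Rightarrow> real) \<Rightarrow> (nat \<Rightarrow> real) \<Rightarrow> real" where
  "orlicz_norm M x = Inf {\<rho>. \<rho> > 0 \<and> orlicz_modular M (\<lambda>n. x n / \<rho>) \<le> 1}"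

definition orlicz_perturbation :: "(real \<Rightarrow> real) \<Rightarrow> (nat \<Rightarrow> real) \<Rightarrow> (nat \<Rightarrow> real) \<Rightarrow> real" where
  "orlicz_perturbation M a x = (\<Sum>n. a n * M \<bar>x n\<bar>)"

text \<open>The functions $f$ and $g$ below are total on sequences; only their values on
  \<^term>\<open>orlicz_space M\<close> matter.\<close>

definition orlicz_lsc :: "(real \<Rightarrow> real) \<Rightarrow> ((nat \<Rightarrow> real) \<Rightarrow> ereal) \<Rightarrow> bool" where
  "orlicz_lsc M f \<longleftrightarrow> (\<forall>x\<in>orlicz_space M. \<forall>c<f x. \<exists>\<delta>>0. \<forall>y\<in>orlicz_space M.
     orlicz_norm M (\<lambda>n. y n - x n) < \<delta> \<longrightarrow> c < f y)"

definition proper_on :: "'a set \<Rightarrow> ('a \<Rightarrow> ereal) \<Rightarrow> bool" where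
  "proper_on S f \<longleftrightarrow> (\<exists>x\<in>S. \<bar>f x\<bar> \<noteq> \<infinity>)"

definition attains_min_on :: "'a set \<Rightarrow> ('a \<Rightarrow> ereal) \<Rightarrow> bool" where
  "attains_min_on S g \<longleftrightarrow> (\<exists>x\<in>S. \<forall>y\<in>S. g x \<le> g y)"

end

theory Submission
  imports Defs
begin

text \<open>Only \<open>u = M(|x|) \<in> \<ell>\<^sub>1\<close> enters the perturbation, which is linear in \<open>u\<close>. Starting from a
  constant weight, which makes the function coercive in \<open>u\<close>, pick successively a point
  \<open>X\<^sub>k\<close> that is \<open>\<tau>\<^sub>k\<close>-minimal for the current weight, and add a small weight \<open>s\<^sub>k\<close> to all coordinates
  beyond an index \<open>N\<^sub>k\<close> so large that this hardly changes the value at \<open>X\<^sub>k\<close>. Since the infimum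
  then grows by little, the new weight forces all later points to have tails beyond \<open>N\<^sub>k\<close> of order
  \<open>\<tau>\<^sub>k / s\<^sub>k\<close>, so the minimizing sequence has uniformly small tails. Under \<open>\<Delta>\<^sub>2\<close> this makes it
  relatively compact in norm, and lower semicontinuity gives a minimum point.\<close>

section \<open>Weighted sums and a variational principle for weights on summable sequences\<close>

lemma summable_weighted:
  fixes a v :: "nat \<Rightarrow> real"
  assumes "summable v" "\<And>n. 0 \<le> v n" "\<And>n. 0 \<le> a n" "\<And>n. a n \<le> B"
  shows "summable (\<lambda>n. a n * v n)"
proof (rule summable_comparison_test)
  show "\<exists>N. \<forall>n\<ge>N. norm (a n * v n) \<le> B * v n"
    using assms by (auto simp: abs_mult intro!: mult_right_mono)
  show "summable (\<lambda>n. B * v n)" using assms by (intro summable_mult)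
qed

text \<open>Adding a weight to all coordinates beyond \<open>N\<close> produces an indicator factor
  under the sum; this converts it into the shifted sum by which tails are measured.\<close>

lemma summable_tail: "summable (\<lambda>n. if N \<le> n then v n else 0)"
  and suminf_tail: "(\<Sum>n. if N \<le> n then v n else 0) = (\<Sum>n. v (n + N))"
  if "summable v" for v :: "nat \<Rightarrow> real"
proof -
  let ?w = "\<lambda>n. if N \<le> n then v n else 0"
  have shift: "(\<lambda>n. ?w (n + N)) = (\<lambda>n. v (n + N))" by auto
  show s: "summable ?w"
    by (subst summable_iff_shift[symmetric, of _ N], subst shift) (use that summable_iff_shift in blast)
  show "(\<Sum>n. if N \<le> n then v n else 0) = (\<Sum>n. v (n + N))"
    using suminf_split_initial_segment[OF s, of N] by (simp add: shift)
qed

text \<open>\<open>D\<close> carries no topology: compactness and semicontinuity are left to the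
  application. Minimality of \<open>X j\<close> for the limit weight \<open>a\<close> is therefore
  only asymptotic, against each fixed competitor \<open>y\<close>.\<close>

lemma l1_weight_variational_principle:
  fixes F :: "'a \<Rightarrow> real" and u :: "'a \<Rightarrow> nat \<Rightarrow> real"
  assumes ne: "D \<noteq> {}" and b: "\<And>x. x \<in> D \<Longrightarrow> b \<le> F x"
    and u0: "\<And>x n. x \<in> D \<Longrightarrow> 0 \<le> u x n" and us: "\<And>x. x \<in> D \<Longrightarrow> summable (u x)"
    and c: "c > 0"
  obtains a :: "nat \<Rightarrow> real" and X :: "nat \<Rightarrow> 'a" and C :: real
  where "\<And>n. 0 \<le> a n" "\<And>n. a n \<le> 2 * c" "\<And>j. X j \<in> D" "\<And>j. suminf (u (X j)) \<le> C"
    and "\<And>\<eta>. \<eta> > 0 \<Longrightarrow> \<exists>N. \<forall>\<^sub>F j in sequentially. (\<Sum>n. u (X j) (n + N)) \<le> \<eta>"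
    and "\<And>y \<delta>. y \<in> D \<Longrightarrow> \<delta> > 0 \<Longrightarrow> \<forall>\<^sub>F j in sequentially.
           F (X j) + (\<Sum>n. a n * u (X j) n) \<le> F y + (\<Sum>n. a n * u y n) + \<delta>"
proof -
  define h where "h = (\<lambda>a x. F x + (\<Sum>n. a n * u x n))"
  \<comment> \<open>The lower bound \<open>c\<close> gives coercivity, the upper bound
    \<open>2 * c\<close> keeps the final weight small.\<close>
  define adm where "adm = (\<lambda>a::nat\<Rightarrow>real. \<forall>n. c \<le> a n \<and> a n \<le> 2 * c)"
  define tail where "tail = (\<lambda>N x. \<Sum>n. u x (n + N))"
  \<comment> \<open>The \<open>s k\<close> add up to \<open>c\<close>, so the weights stay below
    \<open>2 * c\<close>; the \<open>\<tau> k\<close> decay so much faster that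
    \<open>\<tau> k / s k\<close> still tends to 0.\<close>
  define s where "s = (\<lambda>k. c / 2 ^ Suc k)"
  define \<tau> where "\<tau> = (\<lambda>k. 1 / 4 ^ k :: real)"
  have s0: "s k > 0" and \<tau>0: "\<tau> k > 0" and \<tau>_Suc: "\<tau> (Suc k) = \<tau> k / 4"
    and "\<tau> 0 = 1" for k
    using c by (auto simp: s_def \<tau>_def)
  have summ: "summable (\<lambda>n. a n * u x n)" if "adm a" "x \<in> D" for a x
    using that c by (intro summable_weighted[where B = "2 * c"] us u0)
      (auto simp: adm_def intro: order_trans[of 0 c])
  have gnn: "0 \<le> a n * u x n" if "adm a" "x \<in> D" for a x n
    using that c u0[of x n] by (auto simp: adm_def intro!: mult_nonneg_nonneg intro: order_trans[of 0 c])
  have h_mono: "h a x \<le> h a' x" if "adm a" "adm a'" "x \<in> D" "\<And>n. a n \<le> a' n" for a a' x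
    unfolding h_def using that by (intro add_left_mono suminf_le summ mult_right_mono u0) auto
  have pick: "\<exists>x N. x \<in> D \<and> (\<forall>y\<in>D. h a x \<le> h a y + \<tau> k) \<and> s k * tail N x \<le> \<tau> k"
    if adm: "adm a" for a k
  proof -
    have bdd: "bdd_below (h a ` D)"
      unfolding h_def using b gnn summ adm by (intro bdd_belowI2[of _ b]) (fastforce intro: add_increasing2 suminf_nonneg)
    have "Inf (h a ` D) < Inf (h a ` D) + \<tau> k" using \<tau>0 by simp
    then obtain x where x: "x \<in> D" "h a x < Inf (h a ` D) + \<tau> k"
      using cInf_lessD[of "h a ` D"] ne by blast
    have "h a x \<le> h a y + \<tau> k" if "y \<in> D" for y
      using cInf_lower[OF _ bdd, of "h a y"] x that by auto
    moreover obtain N where "\<forall>n\<ge>N. norm (tail n x) < \<tau> k / s k"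
      unfolding tail_def using suminf_exist_split[OF _ us[OF x(1)], of "\<tau> k / s k"] s0 \<tau>0 by auto
    then have "s k * tail N x \<le> \<tau> k"
      using s0[of k] by (smt (verit) order_refl pos_less_divide_eq real_norm_def mult.commute)
    ultimately show ?thesis using x by blast
  qed
  \<comment> \<open>A state consists of the weight, a near-minimizer for it and a cut index. The gap
    \<open>c / 2 ^ k\<close> below \<open>2 * c\<close> is exactly the sum of all increments
    \<open>s i\<close> with \<open>i \<ge> k\<close>.\<close>
  define P where "P = (\<lambda>k (a, x, N). (\<forall>n. c \<le> a n \<and> a n \<le> 2 * c - c / 2 ^ k) \<and> x \<in> D \<and>
     (\<forall>y\<in>D. h a x \<le> h a y + \<tau> k) \<and> s k * tail N x \<le> \<tau> k)"
  define Q where "Q = (\<lambda>k (a, x::'a, N::nat) (a', x'::'a, N'::nat).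
     a' = (\<lambda>n. a n + (if N \<le> n then s k else 0)))"
  have "\<exists>S. \<forall>k. P k (S k) \<and> Q k (S k) (S (Suc k))"
  proof (rule dependent_nat_choice)
    have "adm (\<lambda>_. c)" using c by (auto simp: adm_def)
    from pick[OF this, of 0] obtain x N where
      "x \<in> D \<and> (\<forall>y\<in>D. h (\<lambda>_. c) x \<le> h (\<lambda>_. c) y + \<tau> 0) \<and> s 0 * tail N x \<le> \<tau> 0" by blast
    then have "P 0 (\<lambda>_. c, x, N)" by (simp add: P_def)
    then show "\<exists>t. P 0 t" by blast
  next
    fix t k assume P: "P k t"
    obtain a x N where t: "t = (a, x, N)" by (cases t)
    define a' where "a' = (\<lambda>n. a n + (if N \<le> n then s k else 0))"
    have a: "c \<le> a n" "a n \<le> 2 * c - c / 2 ^ k" for n using P by (auto simp: t P_def)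
    have a': "c \<le> a' n" "a' n \<le> 2 * c - c / 2 ^ Suc k" for n
    proof -
      show "c \<le> a' n" using a(1)[of n] s0[of k] by (auto simp: a'_def)
      have "a' n \<le> a n + s k" using s0[of k] by (auto simp: a'_def)
      also have "\<dots> \<le> 2 * c - c / 2 ^ Suc k" using a(2)[of n] by (simp add: s_def)
      finally show "a' n \<le> 2 * c - c / 2 ^ Suc k" .
    qed
    have "c / 2 ^ Suc k \<ge> 0" using c by auto
    then have "adm a'" using a' unfolding adm_def by (smt (verit))
    from pick[OF this, of "Suc k"] obtain x' N' where
      "x' \<in> D \<and> (\<forall>y\<in>D. h a' x' \<le> h a' y + \<tau> (Suc k)) \<and> s (Suc k) * tail N' x' \<le> \<tau> (Suc k)" by blast
    with a' have "P (Suc k) (a', x', N')" by (simp add: P_def)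
    moreover have "Q k t (a', x', N')" by (simp add: Q_def t a'_def)
    ultimately show "\<exists>t'. P (Suc k) t' \<and> Q k t t'" by blast
  qed
  then obtain S where S: "\<And>k. P k (S k)" "\<And>k. Q k (S k) (S (Suc k))" by blast
  define A where "A = (\<lambda>k. fst (S k))"
  define X where "X = (\<lambda>k. fst (snd (S k)))"
  define N where "N = (\<lambda>k. snd (snd (S k)))"
  have SK: "S k = (A k, X k, N k)" for k by (simp add: A_def X_def N_def)
  have Ac: "c \<le> A k n" "A k n \<le> 2 * c - c / 2 ^ k" for k n
    using S(1)[of k] by (auto simp: P_def SK)
  have XD: "X k \<in> D" and Xmin: "y \<in> D \<Longrightarrow> h (A k) (X k) \<le> h (A k) y + \<tau> k"
    and Xtail: "s k * tail (N k) (X k) \<le> \<tau> k" for k y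
    using S(1)[of k] by (auto simp: P_def SK)
  have A_Suc: "A (Suc k) = (\<lambda>n. A k n + (if N k \<le> n then s k else 0))" for k
    using S(2)[of k] by (auto simp: Q_def SK)
  have A_adm: "adm (A k)" for k
  proof -
    have "c / 2 ^ k \<ge> 0" using c by auto
    then show ?thesis using Ac unfolding adm_def by (smt (verit))
  qed
  have h_Suc: "h (A (Suc k)) x = h (A k) x + s k * tail (N k) x" if "x \<in> D" for k x
  proof -
    have "(\<Sum>n. A (Suc k) n * u x n)
        = (\<Sum>n. A k n * u x n + s k * (if N k \<le> n then u x n else 0))"
      by (rule suminf_cong) (auto simp: A_Suc algebra_simps)
    also have "\<dots> = (\<Sum>n. A k n * u x n) + s k * tail (N k) x"
      using that us by (subst suminf_add[symmetric])
        (auto simp: tail_def suminf_tail suminf_mult summable_tail intro!: summ A_adm summable_mult)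
    finally show ?thesis by (simp add: h_def)
  qed
  have incA: "incseq (\<lambda>k. A k n)" for n
    by (rule incseq_SucI) (use s0 in \<open>auto simp: A_Suc less_imp_le\<close>)
  \<comment> \<open>The slack \<open>c / 2 ^ k\<close> pays for all later increments. This yields
    \<open>a n \<le> A k n + c / 2 ^ k\<close>, a bound uniform in \<open>n\<close>.\<close>
  have decA: "decseq (\<lambda>k. A k n + c / 2 ^ k)" for n
  proof (rule decseq_SucI)
    fix k
    have "A (Suc k) n \<le> A k n + s k" using s0[of k] by (auto simp: A_Suc)
    then show "A (Suc k) n + c / 2 ^ Suc k \<le> A k n + c / 2 ^ k" by (simp add: s_def)
  qed
  have pow0: "(\<lambda>k. c / 2 ^ k) \<longlonglongrightarrow> 0"
    using tendsto_mult_right_zero[OF LIMSEQ_power_zero[of "1/2::real"], of c]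
    by (simp add: power_one_over field_simps)
  have \<tau>lim: "\<tau> \<longlonglongrightarrow> 0"
    using LIMSEQ_power_zero[of "1/4::real"] unfolding \<tau>_def by (simp add: power_one_over field_simps)
  have "\<exists>l. (\<lambda>k. A k n) \<longlonglongrightarrow> l" for n
  proof -
    have "A k n \<le> 2 * c" for k using A_adm[of k] by (simp add: adm_def)
    then show ?thesis using incseq_convergent[OF incA] by metis
  qed
  then obtain a where a: "\<And>n. (\<lambda>k. A k n) \<longlonglongrightarrow> a n" by metis
  have Aa: "A k n \<le> a n" for k n using incseq_le[OF incA a] .
  have aA: "a n \<le> A k n + c / 2 ^ k" for k n
    using decseq_ge[OF decA, of n "a n" k] tendsto_add[OF a pow0] by simp
  have adm_a: "adm a"
  proof -
    have "c \<le> a n" "a n \<le> 2 * c" for n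
      using order_trans[OF Ac(1) Aa] LIMSEQ_le_const2[OF a, of n "2 * c"] A_adm by (auto simp: adm_def)
    then show ?thesis by (auto simp: adm_def)
  qed
  \<comment> \<open>One step raises the value by at most \<open>\<tau> j + \<tau> (Suc j)\<close>,
    which is 5/4 of \<open>\<tau> j\<close>, while the correction term drops by 3/2 of
    \<open>\<tau> j\<close>.\<close>
  have descent: "decseq (\<lambda>j. h (A j) (X j) + 2 * \<tau> j)"
  proof (rule decseq_SucI)
    fix j
    have "h (A (Suc j)) (X (Suc j)) \<le> h (A (Suc j)) (X j) + \<tau> (Suc j)" by (rule Xmin[OF XD])
    also have "\<dots> \<le> h (A j) (X j) + \<tau> j + \<tau> (Suc j)" using Xtail[of j] by (simp add: h_Suc XD)
    finally show "h (A (Suc j)) (X (Suc j)) + 2 * \<tau> (Suc j) \<le> h (A j) (X j) + 2 * \<tau> j"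
      using \<tau>0[of j] by (simp add: \<tau>_Suc)
  qed
  \<comment> \<open>For \<open>j > k\<close> the weight \<open>A j\<close> dominates
    \<open>A (Suc k)\<close>, which charges the tail beyond \<open>N k\<close> at rate
    \<open>s k\<close>. The charge is at most \<open>3 * \<tau> k\<close>: two from the descent, one
    from near-minimality of \<open>X k\<close>.\<close>
  have Xtails: "tail (N k) (X j) \<le> 3 * \<tau> k / s k" if "k < j" for k j
  proof -
    have "h (A k) (X j) + s k * tail (N k) (X j) = h (A (Suc k)) (X j)" by (simp add: h_Suc XD)
    also have "\<dots> \<le> h (A j) (X j)"
      using that incseqD[OF incA, of "Suc k" j] by (intro h_mono A_adm XD) auto
    also have "\<dots> \<le> h (A k) (X k) + 2 * \<tau> k"
      using decseqD[OF descent, of k j] \<tau>0[of j] that by simp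
    also have "\<dots> \<le> h (A k) (X j) + 3 * \<tau> k" using Xmin[OF XD, of k j] by simp
    finally show ?thesis using s0[of k] by (simp add: field_simps)
  qed
  \<comment> \<open>Weights are at least \<open>c\<close> and \<open>F\<close> is at least
    \<open>b\<close>; the 2 is the descent correction \<open>2 * \<tau> 0\<close>.\<close>
  define C where "C = (h (A 0) (X 0) + 2 - b) / c"
  have C: "suminf (u (X j)) \<le> C" for j
  proof -
    have "b + c * suminf (u (X j)) \<le> F (X j) + (\<Sum>n. c * u (X j) n)"
      using b[OF XD] us[OF XD] by (simp add: suminf_mult)
    also have "\<dots> \<le> h (A j) (X j)"
      unfolding h_def using us[OF XD] Ac u0[OF XD]
      by (intro add_left_mono suminf_le summ A_adm XD summable_mult mult_right_mono)
    also have "\<dots> \<le> h (A 0) (X 0) + 2"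
      using decseqD[OF descent, of 0 j] \<tau>0[of j] \<open>\<tau> 0 = 1\<close> by simp
    finally show ?thesis using c by (simp add: C_def field_simps)
  qed
  show thesis
  proof (rule that[of a X C])
    show "0 \<le> a n" "a n \<le> 2 * c" for n using adm_a c by (auto simp: adm_def intro: order_trans[of 0 c])
    show "X j \<in> D" "suminf (u (X j)) \<le> C" for j by (fact XD C)+
    show "\<exists>N. \<forall>\<^sub>F j in sequentially. (\<Sum>n. u (X j) (n + N)) \<le> \<eta>" if "\<eta> > 0" for \<eta>
    proof -
      have "(\<lambda>k. 6 / c * (1/2) ^ k) \<longlonglongrightarrow> 0"
        by (intro tendsto_mult_right_zero LIMSEQ_power_zero) auto
      moreover have "6 / c * (1/2) ^ k = 3 * \<tau> k / s k" for k
      proof -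
        have "(4::real) ^ k = 2 ^ k * 2 ^ k" by (simp flip: power_mult_distrib)
        then show ?thesis by (simp add: \<tau>_def s_def power_one_over field_simps)
      qed
      ultimately have "\<forall>\<^sub>F k in sequentially. 3 * \<tau> k / s k < \<eta>"
        using order_tendstoD(2)[of _ 0 sequentially \<eta>] that by simp
      then obtain k where "3 * \<tau> k / s k < \<eta>" by (auto simp: eventually_sequentially)
      then have "\<forall>j>k. (\<Sum>n. u (X j) (n + N k)) \<le> \<eta>"
        using Xtails[of k] unfolding tail_def by force
      then show ?thesis using eventually_gt_at_top[of k] by (blast intro: eventually_mono)
    qed
    fix y \<delta> assume y: "y \<in> D" and \<delta>: "\<delta> > (0::real)"
    \<comment> \<open>Replacing \<open>A j\<close> by \<open>a\<close> costs at most
      \<open>c / 2 ^ j * C\<close> at \<open>X j\<close>, since the sums of \<open>u (X j)\<close>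
      are bounded by \<open>C\<close>. At \<open>y\<close> the replacement only increases the
      right-hand side.\<close>
    have bound: "h a (X j) \<le> h a y + (\<tau> j + c / 2 ^ j * C)" for j
    proof -
      have "(\<Sum>n. a n * u (X j) n) \<le> (\<Sum>n. A j n * u (X j) n + c / 2 ^ j * u (X j) n)"
        using aA u0[OF XD]
        unfolding distrib_right[symmetric]
        by (intro suminf_le mult_right_mono) (auto simp: distrib_right intro!: summable_add summ A_adm adm_a XD summable_mult us simp del: times_divide_eq_left)
      also have "\<dots> = (\<Sum>n. A j n * u (X j) n) + c / 2 ^ j * suminf (u (X j))"
        by (subst suminf_add[symmetric])
          (use us[OF XD] in \<open>auto intro!: summ A_adm XD summable_mult simp: suminf_mult simp del: times_divide_eq_left\<close>)
      finally have "h a (X j) \<le> h (A j) (X j) + c / 2 ^ j * suminf (u (X j))" by (simp add: h_def)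
      also have "\<dots> \<le> h (A j) (X j) + c / 2 ^ j * C"
        using C c by (intro add_left_mono mult_left_mono) auto
      also have "\<dots> \<le> h (A j) y + \<tau> j + c / 2 ^ j * C" using Xmin[OF y] by simp
      also have "\<dots> \<le> h a y + \<tau> j + c / 2 ^ j * C"
        using h_mono[OF A_adm adm_a y Aa] by simp
      finally show ?thesis by simp
    qed
    have "(\<lambda>j. \<tau> j + c / 2 ^ j * C) \<longlonglongrightarrow> 0 + 0 * C" by (intro tendsto_intros \<tau>lim pow0)
    then have "\<forall>\<^sub>F j in sequentially. \<tau> j + c / 2 ^ j * C < \<delta>" using \<delta> order_tendstoD(2) by fastforce
    then show "\<forall>\<^sub>F j in sequentially. F (X j) + (\<Sum>n. a n * u (X j) n) \<le> F y + (\<Sum>n. a n * u y n) + \<delta>"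
    proof eventually_elim
      case (elim j)
      with bound[of j] show ?case unfolding h_def by linarith
    qed
  qed
qed

section \<open>Coordinatewise limits of sequences\<close>

text \<open>Each finite partial sum passes to the limit. The bound is assumed only eventually, so
  that the lemma also applies to tails.\<close>

lemma suminf_Fatou:
  fixes v :: "nat \<Rightarrow> nat \<Rightarrow> real"
  assumes v0: "\<And>j n. 0 \<le> v j n" and vs: "\<And>j. summable (v j)"
    and lim: "\<And>n. (\<lambda>j. v j n) \<longlonglongrightarrow> w n"
    and ev: "\<forall>\<^sub>F j in sequentially. suminf (v j) \<le> \<eta>"
  shows "summable w" "suminf w \<le> \<eta>"
proof -
  have part: "sum w {..<m} \<le> \<eta>" for m
  proof (rule tendsto_upperbound)
    show "(\<lambda>j. sum (v j) {..<m}) \<longlonglongrightarrow> sum w {..<m}" by (intro tendsto_sum lim)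
    show "\<forall>\<^sub>F j in sequentially. sum (v j) {..<m} \<le> \<eta>"
      using ev by eventually_elim (rule order_trans[OF sum_le_suminf[OF vs]], use v0 in auto)
  qed auto
  have "0 \<le> w n" for n using LIMSEQ_le_const[OF lim] v0 by blast
  then show "summable w"
    using part by (intro summableI_nonneg_bounded)
  then show "suminf w \<le> \<eta>" using part by (rule suminf_le_const)
qed

text \<open>By Tychonoff the cube is compact in the product topology, and a countable product of
  real lines is first countable, so compactness gives convergent subsequences.\<close>

lemma pointwise_convergent_subsequence:
  fixes X :: "nat \<Rightarrow> nat \<Rightarrow> real"
  assumes "\<And>j n. \<bar>X j n\<bar> \<le> R"
  obtains r l where "strict_mono r" "\<And>n. (\<lambda>j. X (r j) n) \<longlonglongrightarrow> l n"
proof -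
  have "compactin (product_topology (\<lambda>_. euclidean) UNIV) (\<Pi>\<^sub>E n\<in>(UNIV::nat set). {-R..R::real})"
    by (simp add: compactin_PiE)
  then have "seq_compact (\<Pi>\<^sub>E n\<in>(UNIV::nat set). {-R..R::real})"
    by (intro compact_imp_seq_compact) (simp add: euclidean_product_topology)
  moreover have "\<forall>j. X j \<in> (\<Pi>\<^sub>E n\<in>UNIV. {-R..R})"
    using assms by (auto simp: abs_le_iff minus_le_iff)
  ultimately obtain l r where r: "strict_mono r" and lim: "(X \<circ> r) \<longlonglongrightarrow> l"
    by (metis seq_compactE)
  from lim have "limitin (product_topology (\<lambda>_. euclidean) UNIV) (X \<circ> r) l sequentially"
    by (simp add: euclidean_product_topology)
  then have "(\<lambda>j. X (r j) n) \<longlonglongrightarrow> l n" for n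
    by (simp add: limitin_componentwise)
  with r that show thesis by blast
qed

section \<open>Growth of Orlicz functions\<close>

lemma orlicz_nonneg: "orlicz M \<Longrightarrow> 0 \<le> t \<Longrightarrow> 0 \<le> M t"
  and orlicz_mono: "orlicz M \<Longrightarrow> 0 \<le> s \<Longrightarrow> s \<le> t \<Longrightarrow> M s \<le> M t"
  by (auto simp: orlicz_def mono_on_def)

lemma orlicz_tendsto:
  assumes "orlicz M" "(g \<longlongrightarrow> l) G" "0 \<le> l" "\<And>x. 0 \<le> g x"
  shows "((\<lambda>x. M (g x)) \<longlongrightarrow> M l) G"
  using assms by (intro continuous_on_tendsto_compose[of "{0..}" M]) (auto simp: orlicz_def)

lemma orlicz_sublevel_bounded:
  assumes "orlicz M"
  obtains R where "R > 0" "\<And>t. M t \<le> C \<Longrightarrow> t \<le> R"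
proof -
  have "\<forall>\<^sub>F t in at_top. C < M t"
    using assms by (auto simp: orlicz_def filterlim_at_top_dense)
  then obtain R where R: "\<And>t. t \<ge> R \<Longrightarrow> C < M t" by (auto simp: eventually_at_top_linorder)
  have "t \<le> max R 1" if "M t \<le> C" for t
    using R[of t] that by linarith
  then show thesis by (intro that[of "max R 1"]) auto
qed

text \<open>The liminf controls the ratio only on some interval \<open>(0, b)\<close>. On
  \<open>[b, R]\<close> monotonicity bounds it by \<open>M (2 * R) / M b\<close>, where
  \<open>M b > 0\<close> by non-degeneracy; hence \<open>K\<close> depends on
  \<open>R\<close>.\<close>

lemma orlicz_doubling:
  assumes M: "orlicz M" and nd: "\<not> degenerate M" and d2: "delta2_at_zero M"
  obtains K where "K \<ge> 0" "\<And>t. 0 \<le> t \<Longrightarrow> t \<le> R \<Longrightarrow> M (2 * t) \<le> K * M t"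
proof -
  have Mpos: "0 < M t" if "0 < t" for t
    using nd orlicz_nonneg[OF M, of t] that by (force simp: degenerate_def)
  obtain c where c: "0 < c" "ereal c < Liminf (at_right 0) (\<lambda>t. ereal (M t / M (2 * t)))"
    using d2 ereal_dense2[of 0] by (auto simp: delta2_at_zero_def)
  then obtain b where b: "b > 0" "\<And>t. 0 < t \<Longrightarrow> t < b \<Longrightarrow> c < M t / M (2 * t)"
    using less_LiminfD[OF c(2)] by (auto simp: eventually_at_right[of 0 1])
  define K where "K = max (1 / c) (M (2 * R) / M b)"
  have "1 / c > 0" using c by simp
  then have K: "K \<ge> 0" "1 / c \<le> K" "M (2 * R) / M b \<le> K" unfolding K_def by linarith+
  show thesis
  proof (rule that[OF K(1)])
    fix t assume t: "0 \<le> t" "t \<le> R"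
    consider "t = 0" | "0 < t" "t < b" | "b \<le> t" using t by linarith
    then show "M (2 * t) \<le> K * M t"
    proof cases
      case 1
      then show ?thesis using M by (simp add: orlicz_def)
    next
      case 2
      then have "M (2 * t) \<le> 1 / c * M t"
        using b(2)[of t] Mpos[of "2 * t"] c(1) by (simp add: field_simps)
      also have "\<dots> \<le> K * M t" using K Mpos 2 by (intro mult_right_mono) (auto intro: less_imp_le)
      finally show ?thesis .
    next
      case 3
      have "M (2 * t) \<le> M (2 * R)" using t by (intro orlicz_mono[OF M]) auto
      also have "\<dots> = M (2 * R) / M b * M b" using Mpos[OF b(1)] by simp
      also have "\<dots> \<le> K * M t"
        using K 3 b t Mpos[OF b(1)] by (intro mult_mono orlicz_mono[OF M]) auto
      finally show ?thesis .
    qed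
  qed
qed

text \<open>Doubling is iterated until \<open>2 ^ p\<close> exceeds \<open>L\<close>. The range of
  arguments grows to \<open>2 ^ p * R\<close>, so each round takes a new doubling constant.\<close>

lemma orlicz_dilation:
  assumes M: "orlicz M" and nd: "\<not> degenerate M" and d2: "delta2_at_zero M"
    and L: "L \<ge> 0"
  obtains K where "K \<ge> 0" "\<And>t. 0 \<le> t \<Longrightarrow> t \<le> R \<Longrightarrow> M (L * t) \<le> K * M t"
proof -
  have pow: "\<exists>K\<ge>0. \<forall>t. 0 \<le> t \<longrightarrow> t \<le> R \<longrightarrow> M (2 ^ p * t) \<le> K * M t" for p :: nat
  proof (induction p)
    case 0
    show ?case by (auto intro!: exI[of _ 1])
  next
    case (Suc p)
    then obtain K where K: "K \<ge> 0" "\<And>t. 0 \<le> t \<Longrightarrow> t \<le> R \<Longrightarrow> M (2 ^ p * t) \<le> K * M t" by blast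
    obtain K' where K': "K' \<ge> 0" "\<And>t. 0 \<le> t \<Longrightarrow> t \<le> 2 ^ p * R \<Longrightarrow> M (2 * t) \<le> K' * M t"
      using orlicz_doubling[OF M nd d2, of "2 ^ p * R"] by blast
    have "M (2 ^ Suc p * t) \<le> (K' * K) * M t" if t: "0 \<le> t" "t \<le> R" for t
    proof -
      have "M (2 ^ Suc p * t) \<le> K' * M (2 ^ p * t)"
        using K'(2)[of "2 ^ p * t"] t by (simp add: mult.assoc)
      also have "\<dots> \<le> K' * (K * M t)" using K(2)[OF t] K'(1) by (rule mult_left_mono)
      finally show ?thesis by (simp add: mult.assoc)
    qed
    then show ?case using K(1) K'(1) by (intro exI[of _ "K' * K"]) auto
  qed
  obtain p where p: "L < 2 ^ p" using real_arch_pow[of 2 L] by auto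
  obtain K where K: "K \<ge> 0" "\<And>t. 0 \<le> t \<Longrightarrow> t \<le> R \<Longrightarrow> M (2 ^ p * t) \<le> K * M t"
    using pow by blast
  have "M (L * t) \<le> K * M t" if "0 \<le> t" "t \<le> R" for t
  proof (rule order_trans[OF orlicz_mono[OF M] K(2)[OF that]])
    show "0 \<le> L * t" "L * t \<le> 2 ^ p * t" using that L p by (auto intro: mult_right_mono)
  qed
  with K(1) show thesis by (rule that)
qed

section \<open>Modular, space and norm\<close>

lemma orlicz_modular_eq_suminf:
  assumes "orlicz M" "summable (\<lambda>n. M \<bar>x n\<bar>)"
  shows "orlicz_modular M x = ennreal (\<Sum>n. M \<bar>x n\<bar>)"
  unfolding orlicz_modular_def using assms orlicz_nonneg by (intro suminf_ennreal2) auto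

text \<open>Dilation by \<open>\<rho>\<close> carries finiteness of the modular from scale
  \<open>\<rho>\<close> to scale 1, with one constant for all coordinates because \<open>x\<close>
  is bounded. Conversely, a finite sum bounds every \<open>M \<bar>x n\<bar>\<close> and hence
  \<open>x\<close>, and \<open>\<rho> = 1\<close> serves.\<close>

lemma orlicz_space_iff_summable:
  assumes M: "orlicz M" and nd: "\<not> degenerate M" and d2: "delta2_at_zero M"
  shows "x \<in> orlicz_space M \<longleftrightarrow> summable (\<lambda>n. M \<bar>x n\<bar>)"
proof
  assume x: "x \<in> orlicz_space M"
  then obtain \<rho> where \<rho>: "\<rho> > 0" "orlicz_modular M (\<lambda>n. x n / \<rho>) \<noteq> top"
    by (auto simp: orlicz_space_def less_top[symmetric])
  then have s: "summable (\<lambda>n. M \<bar>x n / \<rho>\<bar>)"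
    using summable_suminf_not_top[of "\<lambda>n. M \<bar>x n / \<rho>\<bar>"] orlicz_nonneg[OF M]
    by (auto simp: orlicz_modular_def)
  from x obtain R where R: "\<And>n. \<bar>x n\<bar> \<le> R"
    by (auto simp: orlicz_space_def linf_def bounded_iff)
  obtain K where K: "\<And>t. 0 \<le> t \<Longrightarrow> t \<le> R / \<rho> \<Longrightarrow> M (\<rho> * t) \<le> K * M t"
    using orlicz_dilation[OF M nd d2, of \<rho> "R / \<rho>"] \<rho> by auto
  have "M \<bar>x n\<bar> \<le> K * M \<bar>x n / \<rho>\<bar>" for n
    using K[of "\<bar>x n / \<rho>\<bar>"] R[of n] \<rho>(1) by (simp add: abs_divide divide_right_mono)
  then show "summable (\<lambda>n. M \<bar>x n\<bar>)"
    using orlicz_nonneg[OF M]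
    by (intro summable_comparison_test[OF _ summable_mult[OF s, of K]]) auto
next
  assume s: "summable (\<lambda>n. M \<bar>x n\<bar>)"
  obtain R where R: "\<And>t. M t \<le> (\<Sum>n. M \<bar>x n\<bar>) \<Longrightarrow> t \<le> R"
    using orlicz_sublevel_bounded[OF M] by blast
  have "M \<bar>x n\<bar> \<le> (\<Sum>n. M \<bar>x n\<bar>)" for n
    using sum_le_suminf[OF s, of "{n}"] orlicz_nonneg[OF M] by auto
  then have "\<bar>x n\<bar> \<le> R" for n using R by blast
  then have "x \<in> linf" by (auto simp: linf_def bounded_iff)
  moreover have "orlicz_modular M (\<lambda>n. x n / 1) < \<infinity>"
    by (simp add: orlicz_modular_eq_suminf[OF M s])
  ultimately show "x \<in> orlicz_space M"
    unfolding orlicz_space_def using zero_less_one by blast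
qed

lemma orlicz_norm_le:
  assumes M: "orlicz M" and \<rho>: "\<rho> > 0"
    and s: "summable (\<lambda>n. M \<bar>z n / \<rho>\<bar>)" and le: "(\<Sum>n. M \<bar>z n / \<rho>\<bar>) \<le> 1"
  shows "orlicz_norm M z \<le> \<rho>"
  unfolding orlicz_norm_def
proof (rule cInf_lower)
  show "bdd_below {\<rho>. \<rho> > 0 \<and> orlicz_modular M (\<lambda>n. z n / \<rho>) \<le> 1}"
    by (auto intro: bdd_belowI[of _ 0])
  show "\<rho> \<in> {\<rho>. \<rho> > 0 \<and> orlicz_modular M (\<lambda>n. z n / \<rho>) \<le> 1}"
    using le \<rho> orlicz_modular_eq_suminf[OF M s] by simp
qed

text \<open>The modular of the difference at scale \<open>\<rho>\<close> splits into a finite head,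
  small by coordinatewise convergence, and a tail that dilation bounds by the tails of
  \<open>X j\<close> and \<open>l\<close>. The tail of \<open>l\<close> is small by Fatou.\<close>

lemma orlicz_norm_tendsto_of_uniform_tails:
  assumes M: "orlicz M" and nd: "\<not> degenerate M" and d2: "delta2_at_zero M"
    and Xs: "\<And>j. summable (\<lambda>n. M \<bar>X j n\<bar>)" and XC: "\<And>j. (\<Sum>n. M \<bar>X j n\<bar>) \<le> C"
    and tails: "\<And>\<eta>. \<eta> > 0 \<Longrightarrow> \<exists>N. \<forall>\<^sub>F j in sequentially. (\<Sum>n. M \<bar>X j (n + N)\<bar>) \<le> \<eta>"
    and lim: "\<And>n. (\<lambda>j. X j n) \<longlonglongrightarrow> l n"
  shows "summable (\<lambda>n. M \<bar>l n\<bar>)"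
    and "\<delta> > 0 \<Longrightarrow> \<forall>\<^sub>F j in sequentially. orlicz_norm M (\<lambda>n. X j n - l n) < \<delta>"
proof -
  have Mn: "0 \<le> M \<bar>t\<bar>" for t using orlicz_nonneg[OF M] by simp
  have Mlim: "(\<lambda>j. M \<bar>X j n\<bar>) \<longlonglongrightarrow> M \<bar>l n\<bar>" for n
    by (intro orlicz_tendsto[OF M] tendsto_rabs lim) auto
  show ls: "summable (\<lambda>n. M \<bar>l n\<bar>)"
    by (rule suminf_Fatou[OF Mn Xs Mlim, of C]) (use XC in auto)
  assume \<delta>: "\<delta> > 0"
  \<comment> \<open>Half of \<open>\<delta>\<close>, because the norm bound at scale
    \<open>\<rho>\<close> is not strict.\<close>
  define \<rho> where "\<rho> = \<delta> / 2"
  have \<rho>: "\<rho> > 0" "\<rho> < \<delta>" using \<delta> by (auto simp: \<rho>_def)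
  obtain R where R: "\<And>t. M t \<le> C \<Longrightarrow> t \<le> R" using orlicz_sublevel_bounded[OF M] by blast
  have XR: "\<bar>X j n\<bar> \<le> R" for j n
    using sum_le_suminf[OF Xs, of "{n}" j] Mn XC[of j] by (intro R) simp
  have lR: "\<bar>l n\<bar> \<le> R" for n
    using LIMSEQ_le_const2[OF tendsto_rabs[OF lim]] XR by blast
  obtain K where K: "K \<ge> 0" "\<And>t. 0 \<le> t \<Longrightarrow> t \<le> R \<Longrightarrow> M (2 / \<rho> * t) \<le> K * M t"
    using orlicz_dilation[OF M nd d2, of "2 / \<rho>" R] \<rho> by auto
  define z where "z = (\<lambda>j n. M \<bar>(X j n - l n) / \<rho>\<bar>)"
  have z0: "0 \<le> z j n" for j n unfolding z_def by (rule Mn)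
  have zle: "z j n \<le> K * (M \<bar>X j n\<bar> + M \<bar>l n\<bar>)" for j n
  proof -
    \<comment> \<open>The value \<open>M m\<close> is one of the two summands, so their sum
      dominates it.\<close>
    define m where "m = max \<bar>X j n\<bar> \<bar>l n\<bar>"
    have "\<bar>X j n - l n\<bar> \<le> 2 * m" unfolding m_def by linarith
    then have "\<bar>(X j n - l n) / \<rho>\<bar> \<le> 2 / \<rho> * m"
      using \<rho> by (simp add: abs_divide divide_right_mono)
    then have "z j n \<le> M (2 / \<rho> * m)" unfolding z_def by (intro orlicz_mono[OF M]) auto
    also have "\<dots> \<le> K * M m" using XR lR by (intro K) (auto simp: m_def)
    also have "\<dots> \<le> K * (M \<bar>X j n\<bar> + M \<bar>l n\<bar>)"
      using K(1) Mn[of "X j n"] Mn[of "l n"] by (intro mult_left_mono) (auto simp: m_def max_def)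
    finally show ?thesis .
  qed
  have bs: "summable (\<lambda>n. K * (M \<bar>X j n\<bar> + M \<bar>l n\<bar>))" for j
    by (intro summable_mult summable_add Xs ls)
  have zs: "summable (z j)" for j
    using zle z0 by (intro summable_comparison_test[OF _ bs[of j]]) auto
  \<comment> \<open>Two tails of size \<open>\<eta>\<close>, multiplied by \<open>K\<close>, use up
    at most 1/2 of the allowed modular 1; the head gets the rest. \<open>K + 1\<close> avoids
    division by zero.\<close>
  define \<eta> where "\<eta> = 1 / (4 * (K + 1))"
  have \<eta>: "\<eta> > 0" "K * (2 * \<eta>) \<le> 1 / 2" using K(1) by (auto simp: \<eta>_def field_simps)
  obtain N where N: "\<forall>\<^sub>F j in sequentially. (\<Sum>n. M \<bar>X j (n + N)\<bar>) \<le> \<eta>"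
    using tails[OF \<eta>(1)] by blast
  have Xs': "summable (\<lambda>n. M \<bar>X j (n + N)\<bar>)" for j
    using Xs summable_iff_shift[of "\<lambda>n. M \<bar>X j n\<bar>" N] by blast
  have ls': "summable (\<lambda>n. M \<bar>l (n + N)\<bar>)" and lN: "(\<Sum>n. M \<bar>l (n + N)\<bar>) \<le> \<eta>"
    using suminf_Fatou[OF Mn Xs' Mlim N] by auto
  have "(\<lambda>j. \<Sum>n<N. z j n) \<longlonglongrightarrow> (\<Sum>n<N. M \<bar>(l n - l n) / \<rho>\<bar>)"
    unfolding z_def using \<rho> by (intro tendsto_sum orlicz_tendsto[OF M] tendsto_intros lim) auto
  then have "(\<lambda>j. \<Sum>n<N. z j n) \<longlonglongrightarrow> 0" using M by (simp add: orlicz_def)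
  then have "\<forall>\<^sub>F j in sequentially. (\<Sum>n<N. z j n) < 1 / 2" by (rule order_tendstoD) simp
  with N show "\<forall>\<^sub>F j in sequentially. orlicz_norm M (\<lambda>n. X j n - l n) < \<delta>"
  proof eventually_elim
    case (elim j)
    have "(\<Sum>n. z j (n + N)) \<le> (\<Sum>n. K * (M \<bar>X j (n + N)\<bar> + M \<bar>l (n + N)\<bar>))"
      using zs by (intro suminf_le zle summable_mult summable_add Xs' ls') (simp add: summable_iff_shift)
    also have "\<dots> = K * ((\<Sum>n. M \<bar>X j (n + N)\<bar>) + (\<Sum>n. M \<bar>l (n + N)\<bar>))"
      by (subst suminf_mult[OF summable_add[OF Xs' ls']], subst suminf_add[OF Xs' ls']) simp
    also have "\<dots> \<le> K * (2 * \<eta>)" using elim(1) lN K(1) by (intro mult_left_mono) auto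
    finally have "suminf (z j) \<le> 1"
      using elim(2) \<eta>(2) suminf_split_initial_segment[OF zs, of j N] by linarith
    then have "orlicz_norm M (\<lambda>n. X j n - l n) \<le> \<rho>"
      using zs[of j] unfolding z_def by (intro orlicz_norm_le[OF M \<rho>(1)])
    with \<rho>(2) show ?case by simp
  qed
qed

section \<open>Existence of a minimum point for the perturbed function\<close>

theorem theorem4p3:
  fixes M :: "real \<Rightarrow> real" and f :: "(nat \<Rightarrow> real) \<Rightarrow> ereal" and \<epsilon> :: real
  assumes "orlicz M" and "\<not> degenerate M" and "delta2_at_zero M"
    and "\<forall>x\<in>orlicz_space M. f x \<noteq> -\<infinity>"
    and "proper_on (orlicz_space M) f"
    and "orlicz_lsc M f"
    and "\<exists>b::real. \<forall>x\<in>orlicz_space M. ereal b \<le> f x"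
    and "\<epsilon> > 0"
  shows "\<exists>a\<in>linf. linf_norm a < \<epsilon> \<and>
    attains_min_on (orlicz_space M) (\<lambda>x. f x + ereal (orlicz_perturbation M a x))"
proof -
  note M = assms(1) and nd = assms(2) and d2 = assms(3)
  have space: "x \<in> orlicz_space M \<longleftrightarrow> summable (\<lambda>n. M \<bar>x n\<bar>)" for x
    by (rule orlicz_space_iff_summable[OF M nd d2])
  have Mn: "0 \<le> M \<bar>t\<bar>" for t using orlicz_nonneg[OF M] by simp
  \<comment> \<open>The effective domain, on which \<open>f\<close> is the real function
    \<open>F\<close>; elsewhere on the space \<open>f\<close> is infinite and the final comparison
    is trivial.\<close>
  define D where "D = {x \<in> orlicz_space M. \<bar>f x\<bar> \<noteq> \<infinity>}"
  define F where "F = (\<lambda>x. real_of_ereal (f x))"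
  have F: "f x = ereal (F x)" if "x \<in> D" for x
    using that by (simp add: D_def F_def ereal_real')
  obtain b :: real where b: "\<And>x. x \<in> orlicz_space M \<Longrightarrow> ereal b \<le> f x" using assms(7) by blast
  have Fb: "b \<le> F x" if "x \<in> D" for x
    using b[of x] F[OF that] that by (simp add: D_def)
  have ne: "D \<noteq> {}" using assms(5) by (auto simp: proper_on_def D_def)
  have Ds: "summable (\<lambda>n. M \<bar>x n\<bar>)" if "x \<in> D" for x
    using that space by (simp add: D_def)
  \<comment> \<open>Weights up to \<open>2 * (\<epsilon> / 4)\<close> leave room for the strict
    bound on the norm.\<close>
  have eps: "\<epsilon> / 4 > 0" using assms(8) by simp
  obtain a X C where a: "\<And>n. 0 \<le> a n" "\<And>n. a n \<le> 2 * (\<epsilon> / 4)"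
    and XD: "\<And>j. X j \<in> D" and XC: "\<And>j. (\<Sum>n. M \<bar>X j n\<bar>) \<le> C"
    and tails: "\<And>\<eta>. \<eta> > 0 \<Longrightarrow> \<exists>N. \<forall>\<^sub>F j in sequentially. (\<Sum>n. M \<bar>X j (n + N)\<bar>) \<le> \<eta>"
    and min: "\<And>y \<delta>. y \<in> D \<Longrightarrow> \<delta> > 0 \<Longrightarrow> \<forall>\<^sub>F j in sequentially.
           F (X j) + (\<Sum>n. a n * M \<bar>X j n\<bar>) \<le> F y + (\<Sum>n. a n * M \<bar>y n\<bar>) + \<delta>"
  proof (rule l1_weight_variational_principle[of D b F "\<lambda>x n. M \<bar>x n\<bar>" "\<epsilon> / 4"], goal_cases)
    case (6 a X C)
    show ?case by (rule 6(1)[OF 6(2-)])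
  qed (use ne Fb Mn Ds eps in auto)
  define G where "G = (\<lambda>x. \<Sum>n. a n * M \<bar>x n\<bar>)"
  have Gs: "summable (\<lambda>n. a n * M \<bar>x n\<bar>)" if "x \<in> orlicz_space M" for x
    using that space a Mn by (intro summable_weighted[where B = "2 * (\<epsilon> / 4)"]) auto
  obtain R where R: "\<And>t. M t \<le> C \<Longrightarrow> t \<le> R" using orlicz_sublevel_bounded[OF M] by blast
  have "\<bar>X j n\<bar> \<le> R" for j n
    using sum_le_suminf[OF Ds[OF XD], of "{n}" j] Mn XC[of j] by (intro R) simp
  then obtain r l where r: "strict_mono r" and lim: "\<And>n. (\<lambda>j. X (r j) n) \<longlonglongrightarrow> l n"
    using pointwise_convergent_subsequence by blast
  define Y where "Y = (\<lambda>j. X (r j))"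
  have YD: "Y j \<in> D" for j by (simp add: Y_def XD)
  \<comment> \<open>Small tails and asymptotic minimality are eventual statements, so the
    subsequence inherits them.\<close>
  have sub: "\<forall>\<^sub>F j in sequentially. P (r j)" if "\<forall>\<^sub>F j in sequentially. P j" for P
    using that r by (rule eventually_subseq[rotated])
  have Ytails: "\<exists>N. \<forall>\<^sub>F j in sequentially. (\<Sum>n. M \<bar>Y j (n + N)\<bar>) \<le> \<eta>" if "\<eta> > 0" for \<eta>
  proof -
    obtain N where "\<forall>\<^sub>F j in sequentially. (\<Sum>n. M \<bar>X j (n + N)\<bar>) \<le> \<eta>" using tails[OF \<open>\<eta> > 0\<close>] by blast
    from sub[OF this] show ?thesis unfolding Y_def by blast
  qed
  have Ymin: "\<forall>\<^sub>F j in sequentially. F (Y j) + G (Y j) \<le> F y + G y + \<delta>" if "y \<in> D" "\<delta> > 0" for y \<delta>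
    using sub[OF min[OF that]] by (simp add: Y_def G_def)
  have YC: "(\<Sum>n. M \<bar>Y j n\<bar>) \<le> C" for j unfolding Y_def by (rule XC)
  have Ylim: "(\<lambda>j. Y j n) \<longlonglongrightarrow> l n" for n using lim by (simp add: Y_def)
  note conv = orlicz_norm_tendsto_of_uniform_tails[OF M nd d2 Ds[OF YD] YC _ Ylim]
  have l: "l \<in> orlicz_space M" unfolding space by (rule conv(1)[OF Ytails])
  have Ynorm: "\<forall>\<^sub>F j in sequentially. orlicz_norm M (\<lambda>n. Y j n - l n) < \<delta>" if "\<delta> > 0" for \<delta>
    by (rule conv(2)[OF Ytails that])
  have flsc: "\<forall>\<^sub>F j in sequentially. q < F (Y j)" if q: "ereal q < f l" for q
  proof -
    obtain \<delta> where \<delta>: "\<delta> > 0"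
      "\<And>y. y \<in> orlicz_space M \<Longrightarrow> orlicz_norm M (\<lambda>n. y n - l n) < \<delta> \<Longrightarrow> ereal q < f y"
      using assms(6)[unfolded orlicz_lsc_def, rule_format, OF l q] by blast
    show ?thesis
      using Ynorm[OF \<delta>(1)]
    proof eventually_elim
      case (elim j)
      then show ?case using \<delta>(2)[of "Y j"] YD[of j] F[OF YD[of j]] by (simp add: D_def)
    qed
  qed
  \<comment> \<open>At this point \<open>f l\<close> may still be infinite, so the inequality is
    stated in \<open>ereal\<close> and refuted through a real \<open>q\<close> strictly in
    between.\<close>
  have fl: "f l \<le> ereal (F y + G y - G l)" if y: "y \<in> D" for y
  proof (rule ccontr)
    assume "\<not> ?thesis"
    then obtain q where q: "F y + G y - G l < q" "ereal q < f l"
      using ereal_dense2[of "ereal (F y + G y - G l)" "f l"] by (auto simp: not_le)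
    \<comment> \<open>The gap is split in three: truncating \<open>G l\<close> at \<open>N\<close>,
      passing to the limit in the partial sum, and near-minimality of \<open>Y j\<close>.\<close>
    define e where "e = (q - (F y + G y - G l)) / 3"
    have e: "e > 0" "q = F y + G y - G l + 3 * e" using q by (auto simp: e_def field_simps)
    have "(\<lambda>N. \<Sum>n<N. a n * M \<bar>l n\<bar>) \<longlonglongrightarrow> G l"
      unfolding G_def using Gs[OF l] by (rule summable_LIMSEQ)
    then have "\<forall>\<^sub>F N in sequentially. G l - e < (\<Sum>n<N. a n * M \<bar>l n\<bar>)"
      using e by (intro order_tendstoD) auto
    then obtain N where N: "G l - e < (\<Sum>n<N. a n * M \<bar>l n\<bar>)"
      by (auto simp: eventually_sequentially)
    have "(\<lambda>j. \<Sum>n<N. a n * M \<bar>Y j n\<bar>) \<longlonglongrightarrow> (\<Sum>n<N. a n * M \<bar>l n\<bar>)"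
      by (intro tendsto_sum tendsto_mult_left orlicz_tendsto[OF M] tendsto_rabs Ylim) auto
    from order_tendstoD(1)[OF this, of "G l - 2 * e"]
    have "\<forall>\<^sub>F j in sequentially. G l - 2 * e < (\<Sum>n<N. a n * M \<bar>Y j n\<bar>)" using N e by simp
    with flsc[OF q(2)] Ymin[OF y e(1)] have "\<forall>\<^sub>F j in sequentially. False"
    proof eventually_elim
      case (elim j)
      \<comment> \<open>Since \<open>a\<close> is nonnegative, partial sums bound \<open>G\<close>
        from below: this is the lower semicontinuity of \<open>G\<close> along
        \<open>Y\<close>.\<close>
      have "(\<Sum>n<N. a n * M \<bar>Y j n\<bar>) \<le> G (Y j)"
        unfolding G_def using a Mn YD by (intro sum_le_suminf Gs) (auto simp: D_def)
      with elim e show False by linarith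
    qed
    then show False by simp
  qed
  show ?thesis
  proof (intro bexI[of _ a] conjI)
    show "a \<in> linf" using a by (auto simp: linf_def bounded_iff intro!: exI[of _ "2 * (\<epsilon> / 4)"])
    have "linf_norm a \<le> 2 * (\<epsilon> / 4)"
      unfolding linf_norm_def using a by (intro cSUP_least) auto
    then show "linf_norm a < \<epsilon>" using assms(8) by simp
    show "attains_min_on (orlicz_space M) (\<lambda>x. f x + ereal (orlicz_perturbation M a x))"
      unfolding attains_min_on_def
    proof (intro bexI[OF _ l] ballI)
      fix y assume y: "y \<in> orlicz_space M"
      have G: "orlicz_perturbation M a x = G x" for x by (simp add: orlicz_perturbation_def G_def)
      show "f l + ereal (orlicz_perturbation M a l) \<le> f y + ereal (orlicz_perturbation M a y)"
      proof (cases "y \<in> D")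
        case True
        have "f l + ereal (G l) \<le> ereal (F y + G y - G l) + ereal (G l)"
          by (rule add_right_mono[OF fl[OF True]])
        then show ?thesis by (simp add: F[OF True] G)
      next
        case False
        then have "f y = \<infinity>" using y assms(4) by (auto simp: D_def)
        then show ?thesis by simp
      qed
    qed
  qed
qed

end
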